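(* Let $A,C\in\mathbb{R}^{m\times m}$ and $B,D\in\mathbb{R}^{p\times p}$, where $A$ and $B$ are nonsingular. Suppose that $$\rho\big((I-2\Lambda)\,((B^{-1}D)^{T}\otimes CA^{-1})\big)<1$$ for every diagonal matrix $\Lambda=\mathrm{diag}(\lambda_i)\in\mathbb{R}^{mp\times mp}$ with all $\lambda_i\in[0,1]$. Then for every $F\in\mathbb{R}^{m\times p}$ the equation $$AXB-|CXD|=F$$ has a unique solution $X\in\mathbb{R}^{m\times p}$.
   Context: $|M|$ denotes the entrywise absolute value of a real matrix $M$; $\rho(\cdot)$ denotes the spectral radius; $\otimes$ denotes the Kronecker product; $I$ is the identity matrix of the appropriate order. The equation $AXB-|CXD|=F$ is called the new Sylvester-like absolute value equation; in general $A,C\in\mathbb{R}^{m\times n}$, $B,D\in\mathbb{R}^{p\times q}$, $F\in\mathbb{R}^{m\times q}$, and $X\in\mathbb{R}^{n\times p}$ is the unknown. Here $A$ and $B$ are square, so $m=n$ and $p=q$. *)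

theory Defs
  imports "HOL-Analysis.Analysis" "HOL-Computational_Algebra.Fundamental_Theorem_Algebra"
begin

text \<open>The eigenvalues of a real matrix are its complex ones, so that the spectral radius is
  the usual one and not just the largest modulus of a real eigenvalue.\<close>

definition spectrum :: "real ^ 'n ^ 'n \<Rightarrow> complex set" where
  "spectrum A = {\<mu>. \<exists>v. v \<noteq> 0 \<and> map_matrix complex_of_real A *v v = \<mu> *s v}"

definition spectral_radius :: "real ^ 'n ^ 'n \<Rightarrow> real" where
  "spectral_radius A = Max (norm ` spectrum A)"

text \<open>Rows and columns are indexed by pairs; block \<open>(i, j)\<close> of \<open>P \<otimes> Q\<close> is \<open>P $ i $ j\<close> times \<open>Q\<close>.\<close>

definition kronecker :: "real ^ 'n ^ 'm \<Rightarrow> real ^ 'q ^ 'p \<Rightarrow> real ^ ('n \<times> 'q) ^ ('m \<times> 'p)"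
    (infixl "\<otimes>" 70) where
  "P \<otimes> Q = (\<chi> r c. P $ fst r $ fst c * Q $ snd r $ snd c)"

definition diag :: "real ^ 'n \<Rightarrow> real ^ 'n ^ 'n" where
  "diag l = (\<chi> i j. if i = j then l $ i else 0)"

text \<open>The library's order-theoretic absolute value on vectors, taken on matrices, is the
  entrywise one.\<close>

lemma abs_matrix_entrywise: "\<bar>M :: real ^ 'n ^ 'm\<bar> = (\<chi> i j. \<bar>M $ i $ j\<bar>)"
  by (simp add: abs_vec_def)

lemma spectrum_iff_det:
  "\<mu> \<in> spectrum A \<longleftrightarrow> det (mat \<mu> - map_matrix complex_of_real A) = 0"
proof -
  let ?A = "map_matrix complex_of_real A"
  have "\<mu> *s v = mat \<mu> *v v" for v :: "complex ^ 'a"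
    by (simp add: vec_eq_iff matrix_vector_mult_def mat_def if_distrib[of "\<lambda>x. x * _"] cong: if_cong)
  then have "\<mu> \<in> spectrum A \<longleftrightarrow> (\<exists>v. v \<noteq> 0 \<and> (mat \<mu> - ?A) *v v = 0)"
    unfolding spectrum_def by (auto simp: matrix_vector_mult_diff_rdistrib)
  also have "\<dots> \<longleftrightarrow> det (mat \<mu> - ?A) = 0"
    using invertible_det_nz[of "mat \<mu> - ?A"] invertible_left_inverse[of "mat \<mu> - ?A"]
      matrix_left_invertible_ker[of "mat \<mu> - ?A"] by auto
  finally show ?thesis .
qed

text \<open>Hence the maximum defining the spectral radius is taken over a finite nonempty set.\<close>

lemma spectrum_finite_nonempty:
  fixes A :: "real ^ 'n ^ 'n"
  shows "finite (spectrum A)" and "spectrum A \<noteq> {}"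
proof -
  let ?A = "map_matrix complex_of_real A"
  define p where "p = det (\<chi> i j. [:- (?A $ i $ j), if i = j then 1 else 0:])"
  have poly_p: "poly p \<mu> = det (mat \<mu> - ?A)" for \<mu>
    unfolding p_def det_def
    by (auto simp: poly_sum poly_prod mat_def of_int_poly intro!: sum.cong prod.cong)
  have spec: "spectrum A = {\<mu>. poly p \<mu> = 0}"
    by (auto simp: spectrum_iff_det poly_p)
  define g where "g = (\<lambda>t. det (mat 1 - map_matrix ((*) t) ?A))"
  have scale: "g t = t ^ CARD('n) * poly p (1 / t)" if "t \<noteq> 0" for t
  proof -
    have "mat 1 - map_matrix ((*) t) ?A = (\<chi> i. t *s ((mat (1 / t) - ?A) $ i))"
      using that by (simp add: vec_eq_iff mat_def algebra_simps)
    then have "g t = t ^ CARD('n) * det (\<chi> i. (mat (1 / t) - ?A) $ i)"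
      by (simp only: g_def det_rows_mul prod_constant)
    then show ?thesis by (simp only: poly_p vec_nth_inverse)
  qed
  have "isCont g 0"
    unfolding g_def det_def by (auto intro!: continuous_intros)
  then have "g \<midarrow>0\<rightarrow> g 0" by (rule isContD)
  moreover have "g 0 = 1"
  proof -
    have "mat 1 - map_matrix ((*) 0) ?A = mat 1"
      by (simp add: vec_eq_iff)
    then show ?thesis by (simp add: g_def)
  qed
  ultimately have lim: "g \<midarrow>0\<rightarrow> 1" by simp
  have no_const: False if "\<And>x. poly p x = c" for c
  proof -
    have "(\<lambda>t::complex. t ^ CARD('n) * c) \<midarrow>0\<rightarrow> 0 ^ CARD('n) * c"
      by (intro tendsto_intros)
    then have "(\<lambda>t::complex. t ^ CARD('n) * c) \<midarrow>0\<rightarrow> 0" by (simp add: power_0_left)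
    moreover have "eventually (\<lambda>t. t ^ CARD('n) * c = g t) (at 0)"
      using scale that by (auto simp: eventually_at_filter)
    ultimately have "g \<midarrow>0\<rightarrow> 0" using Lim_transform_eventually by blast
    with lim show False using LIM_unique by fastforce
  qed
  have "p \<noteq> 0" using no_const[of 0] by auto
  then show "finite (spectrum A)" unfolding spec by (rule poly_roots_finite)
  have "\<not> constant (poly p)" using no_const unfolding constant_def by blast
  then show "spectrum A \<noteq> {}" unfolding spec using fundamental_theorem_of_algebra by blast
qed

end

theory Submission
  imports Defs
begin

text \<open>
  The map \<open>X \<mapsto> A X B - |C X D|\<close> is continuous and positively homogeneous. It is injective: if
  \<open>X\<^sub>1\<close> and \<open>X\<^sub>2\<close> have the same image and \<open>Y = A (X\<^sub>1 - X\<^sub>2) B\<close>, then the entries of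
  \<open>Y = |C X\<^sub>1 D| - |C X\<^sub>2 D|\<close> are those of \<open>C A\<^sup>-\<^sup>1 Y B\<^sup>-\<^sup>1 D\<close> multiplied by factors from \<open>[-1, 1]\<close>, and
  with these factors written as \<open>1 - 2 \<lambda>\<^sub>i\<close>, a nonzero \<open>Y\<close> would be an eigenvector for the
  eigenvalue \<open>1\<close> of one of the matrices in the hypothesis. By invariance of domain the range
  is open, so it contains a ball around \<open>0\<close>; by homogeneity it is everything.
\<close>

lemma matrix_diff_ldistrib: "A ** (B - C) = A ** B - A ** (C :: 'a::ring_1 ^ 'n ^ 'm)"
  by (simp add: vec_eq_iff matrix_matrix_mult_def right_diff_distrib sum_subtractf)

lemma matrix_diff_rdistrib: "(A - B) ** C = A ** C - B ** (C :: 'a::ring_1 ^ 'n ^ 'm)"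
  by (simp add: vec_eq_iff matrix_matrix_mult_def left_diff_distrib sum_subtractf)

lemma invertible_matrix_inv:
  assumes "invertible A"
  shows "A ** matrix_inv A = mat 1" and "matrix_inv A ** A = mat 1"
  using someI_ex[OF assms[unfolded invertible_def]] by (auto simp: matrix_inv_def)

lemma norm_le_spectral_radius:
  assumes "\<mu> \<in> spectrum A"
  shows "norm \<mu> \<le> spectral_radius A"
  unfolding spectral_radius_def using assms spectrum_finite_nonempty(1)[of A] by simp

text \<open>A nonzero real fixed vector, embedded in the complex vectors, is an eigenvector for the
  eigenvalue 1, which forces the spectral radius to be at least 1.\<close>

lemma no_fixed_vector_if_spectral_radius_less_1:
  fixes A :: "real ^ 'n ^ 'n"
  assumes "spectral_radius A < 1" and "A *v v = v"
  shows "v = 0"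
proof (rule ccontr)
  assume "v \<noteq> 0"
  define w :: "complex ^ 'n" where "w = (\<chi> i. complex_of_real (v $ i))"
  have "map_matrix complex_of_real A *v w = (\<chi> i. complex_of_real ((A *v v) $ i))"
    by (simp add: w_def vec_eq_iff matrix_vector_mult_def)
  then have "map_matrix complex_of_real A *v w = 1 *s w"
    by (simp add: assms(2) w_def)
  moreover have "w \<noteq> 0"
    using \<open>v \<noteq> 0\<close> by (auto simp: w_def vec_eq_iff)
  ultimately have "1 \<in> spectrum A"
    unfolding spectrum_def by blast
  then show False
    using norm_le_spectral_radius[of 1 A] assms(1) by simp
qed

text \<open>This is the identity vec(Q Y P) = (P^T \<otimes> Q) vec(Y). Stacking columns means that
  an index pair is (column, row), hence the swapped \<open>snd k\<close> and
  \<open>fst k\<close>.\<close>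

lemma kronecker_transpose_mult_vec:
  fixes P :: "real ^ 'q ^ 'p" and Q :: "real ^ 'n ^ 'm" and Y :: "real ^ 'p ^ 'n"
  shows "(transpose P \<otimes> Q) *v (\<chi> k. Y $ snd k $ fst k) = (\<chi> k. (Q ** Y ** P) $ snd k $ fst k)"
proof -
  have "(\<Sum>c\<in>UNIV. P $ fst c $ j * Q $ i $ snd c * Y $ snd c $ fst c)
      = (\<Sum>a\<in>UNIV. (\<Sum>b\<in>UNIV. Q $ i $ b * Y $ b $ a) * P $ a $ j)" for i j
    unfolding sum_distrib_right by (simp add: sum.cartesian_product case_prod_beta mult_ac)
  then show ?thesis
    by (simp add: vec_eq_iff kronecker_def transpose_def matrix_vector_mult_def
        matrix_matrix_mult_def)
qed

lemma diag_mult_vec: "diag l *v v = (\<chi> i. l $ i * v $ i)"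
  by (simp add: vec_eq_iff diag_def matrix_vector_mult_def if_distrib[of "\<lambda>x. x * _"] cong: if_cong)

text \<open>By the reverse triangle inequality the quotient of the two differences lies in [-1, 1];
  the form \<open>1 - 2 * t\<close> matches the diagonal entries of I - 2 \<Lambda>.\<close>

lemma abs_diff_eq_mult:
  fixes a b :: real
  obtains t where "t \<in> {0..1}" and "\<bar>a\<bar> - \<bar>b\<bar> = (1 - 2 * t) * (a - b)"
proof (cases "a = b")
  case True
  then show thesis using that[of 0] by simp
next
  case False
  define s where "s = (\<bar>a\<bar> - \<bar>b\<bar>) / (a - b)"
  have "\<bar>s\<bar> \<le> 1"
    using False by (simp add: s_def abs_divide abs_triangle_ineq3)
  moreover have "s * (a - b) = \<bar>a\<bar> - \<bar>b\<bar>"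
    using False by (simp add: s_def)
  ultimately show thesis
    using that[of "(1 - s) / 2"] by (auto simp: abs_le_iff diff_divide_distrib)
qed

lemma surj_if_inj_pos_homogeneous:
  fixes f :: "'a::euclidean_space \<Rightarrow> 'a"
  assumes cont: "continuous_on UNIV f" and inj: "inj f"
    and hom: "\<And>t x. t \<ge> 0 \<Longrightarrow> f (t *\<^sub>R x) = t *\<^sub>R f x"
  shows "surj f"
proof -
  have "open (range f)"
    using invariance_of_domain[OF cont open_UNIV inj] .
  moreover have "0 \<in> range f"
    using hom[of 0 0] by (metis order_refl rangeI scaleR_zero_left)
  ultimately obtain e where e: "e > 0" "cball 0 e \<subseteq> range f"
    by (meson open_contains_cball)
  have "z \<in> range f" for z
  proof (cases "z = 0")
    case True
    then show ?thesis using \<open>0 \<in> range f\<close> by simp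
  next
    case False
    \<comment> \<open>Rescaled to norm \<open>e\<close>, \<open>z\<close> has a preimage;
      homogeneity undoes the scaling.\<close>
    then have "(e / norm z) *\<^sub>R z \<in> cball 0 e" using e(1) by simp
    then obtain y where "f y = (e / norm z) *\<^sub>R z" using e(2) by (metis rangeE subsetD)
    then have "f ((norm z / e) *\<^sub>R y) = z" using hom[of "norm z / e" y] e(1) False by simp
    then show ?thesis by (metis rangeI)
  qed
  then show ?thesis by auto
qed

theorem theorem2p1:
  fixes A C :: "real ^ 'm ^ 'm" and B D :: "real ^ 'p ^ 'p"
  assumes "invertible A" and "invertible B"
    and "\<And>l :: real ^ ('p \<times> 'm). (\<And>i. l $ i \<in> {0..1}) \<Longrightarrow>
      spectral_radius ((mat 1 - 2 *\<^sub>R diag l) **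
        (transpose (matrix_inv B ** D) \<otimes> (C ** matrix_inv A))) < 1"
  shows "\<forall>F :: real ^ 'p ^ 'm. \<exists>!X :: real ^ 'p ^ 'm. A ** X ** B - \<bar>C ** X ** D\<bar> = F"
proof -
  define f where "f X = A ** X ** B - \<bar>C ** X ** D\<bar>" for X :: "real ^ 'p ^ 'm"
  note inv = invertible_matrix_inv(2)[OF assms(1)] invertible_matrix_inv(1)[OF assms(2)]
  have "inj f"
  proof (rule injI)
    fix X1 X2 assume eq: "f X1 = f X2"
    define Z where "Z = X1 - X2"
    define Y where "Y = A ** Z ** B"
    define y :: "real ^ ('p \<times> 'm)" where "y = (\<chi> k. Y $ snd k $ fst k)"
    \<comment> \<open>Recovering \<open>Z\<close> from \<open>Y\<close> serves twice: to express
      \<open>C ** Z ** D\<close> through \<open>Y\<close>, and at the end to pass from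
      \<open>Y = 0\<close> to \<open>Z = 0\<close>.\<close>
    have "matrix_inv A ** Y ** matrix_inv B = (matrix_inv A ** A) ** Z ** (B ** matrix_inv B)"
      unfolding Y_def matrix_mul_assoc ..
    then have Z_eq: "matrix_inv A ** Y ** matrix_inv B = Z"
      by (simp add: inv)
    have CZD: "C ** matrix_inv A ** Y ** (matrix_inv B ** D) = C ** Z ** D"
      unfolding Z_eq[symmetric] matrix_mul_assoc ..
    have Y_eq: "Y = \<bar>C ** X1 ** D\<bar> - \<bar>C ** X2 ** D\<bar>"
      using eq by (simp add: f_def Y_def Z_def matrix_diff_ldistrib matrix_diff_rdistrib algebra_simps)
    have "\<exists>t. t \<in> {0..1} \<and> Y $ i $ j = (1 - 2 * t) * (C ** Z ** D) $ i $ j" for i j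
      using abs_diff_eq_mult[of "(C ** X1 ** D) $ i $ j" "(C ** X2 ** D) $ i $ j"]
      unfolding Y_eq Z_def matrix_diff_ldistrib matrix_diff_rdistrib abs_vec_def by auto
    then obtain t where t: "\<And>i j. t i j \<in> {0..1}"
      "\<And>i j. Y $ i $ j = (1 - 2 * t i j) * (C ** Z ** D) $ i $ j"
      by metis
    define l :: "real ^ ('p \<times> 'm)" where "l = (\<chi> k. t (snd k) (fst k))"
    let ?K = "transpose (matrix_inv B ** D) \<otimes> (C ** matrix_inv A)"
    have Ky: "?K *v y = (\<chi> k. (C ** Z ** D) $ snd k $ fst k)"
      unfolding y_def kronecker_transpose_mult_vec CZD ..
    \<comment> \<open>Multiplying by I - 2 \<Lambda> scales each entry of \<open>C ** Z ** D\<close>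
      by its own factor \<open>1 - 2 * t i j\<close>, which gives back \<open>Y\<close>; so
      \<open>y\<close> is a fixed vector.\<close>
    have "((mat 1 - 2 *\<^sub>R diag l) ** ?K) *v y = ?K *v y - 2 *\<^sub>R (diag l *v (?K *v y))"
      by (simp add: matrix_vector_mult_diff_rdistrib scaleR_matrix_vector_assoc
          flip: matrix_vector_mul_assoc)
    also have "\<dots> = y"
      unfolding Ky by (simp add: diag_mult_vec vec_eq_iff y_def l_def t(2) algebra_simps)
    finally have "y = 0"
      using no_fixed_vector_if_spectral_radius_less_1 assms(3)[of l] t(1) by (simp add: l_def)
    then have "Y = 0"
      by (auto simp: y_def vec_eq_iff)
    then have "Z = 0"
      using Z_eq by simp
    then show "X1 = X2"
      by (simp add: Z_def)
  qed
  moreover have "continuous_on UNIV f"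
    unfolding f_def abs_vec_def matrix_matrix_mult_def
    by (intro continuous_intros)
  \<comment> \<open>The sign condition on \<open>t\<close> lets it pass through the absolute
    value.\<close>
  moreover have "f (t *\<^sub>R X) = t *\<^sub>R f X" if "t \<ge> 0" for t X
    using that
    by (simp add: f_def matrix_scalar_ac abs_vec_def vec_eq_iff abs_mult right_diff_distrib
        flip: scalar_matrix_assoc)
  ultimately have "bij f"
    using surj_if_inj_pos_homogeneous by (blast intro: bijI)
  then show ?thesis
    by (metis bij_pointE f_def)
qed

end
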